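(* (a) Let $\boldsymbol{d}$ be a graphical degree sequence which satisfies \[ M(\boldsymbol{d})>2J(\boldsymbol{d})+18\Delta(\boldsymbol{d})+56. \] Then $\boldsymbol{d}$ is $(8,8)$-stable. (b) Suppose that $\mathcal{D}$ is a family of graphical degree sequences such that every $\boldsymbol{d}\in\mathcal{D}$ satisfies \[ M(\boldsymbol{d})>2J(\boldsymbol{d})+6\Delta(\boldsymbol{d})+2. \] Then $\mathcal{D}$ is both P-stable and strongly stable.
   Context: A degree sequence is a sequence $\boldsymbol{d}=(d_1,\ldots,d_n)$ of nonnegative integers with even sum (the length $n$ may vary within a family). $\Omega(\boldsymbol{d})$ is the set of all simple graphs on vertex set $[n]=\{1,\ldots,n\}$ in which vertex $i$ has degree $d_i$ for all $i$; $\boldsymbol{d}$ is graphical if $\Omega(\boldsymbol{d})\neq\emptyset$. Let $\|\boldsymbol{x}\|_1=\sum_j|x_j|$, $M(\boldsymbol{d})=\sum_j d_j$, $\Delta(\boldsymbol{d})=\max_j d_j$, and let $J(\boldsymbol{d})$ be the sum of the $\Delta(\boldsymbol{d})$ largest entries of $\boldsymbol{d}$ (counted with multiplicity). $(k,\alpha)$-stability: for a positive integer $k$ and real $\alpha\ge0$, a graphical $\boldsymbol{d}$ is $(k,\alpha)$-stable if $|\Omega(\boldsymbol{d}')|\le M(\boldsymbol{d})^{\alpha}|\Omega(\boldsymbol{d})|$ for every graphical degree sequence $\boldsymbol{d}'$ of length $n$ with $\|\boldsymbol{d}'-\boldsymbol{d}\|_1\le k$. P-stability: let $\Omega'(\boldsymbol{d})=\bigcup_{\boldsymbol{d}'}\Omega(\boldsymbol{d}')$,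 where $\boldsymbol{d}'$ ranges over all graphical degree sequences of length $n$ with $\|\boldsymbol{d}'-\boldsymbol{d}\|_1\le2$ and $d'_j\le d_j$ for all $j\in[n]$. A family $\mathcal{D}$ is P-stable if there is a polynomial $p$ such that $|\Omega'(\boldsymbol{d})|\le p(n)|\Omega(\boldsymbol{d})|$ for all positive integers $n$ and all $\boldsymbol{d}=(d_1,\ldots,d_n)\in\mathcal{D}$. Strong stability: the JS (Jerrum–Sinclair) chain has state space $\Omega'(\boldsymbol{d})$ and the following transitions $G\mapsto G'$ between elements of $\Omega'(\boldsymbol{d})$: insertion ($G'$ is obtained from $G$ by inserting an edge, with $G'\in\Omega(\boldsymbol{d})$); deletion ($G'$ is obtained from $G$ by deleting an edge, with $G\in\Omega(\boldsymbol{d})$); hinge-flip ($G'$ is obtained from $G$ by deleting an edge $uv$ and inserting an edge $wv$, with neither $G$ nor $G'$ in $\Omega(\boldsymbol{d})$). For $G\in\Omega'(\boldsymbol{d})$ let $\operatorname{dist}(G,\boldsymbol{d})$ be the minimum number of JS chain transitions needed to reach an element of $\Omega(\boldsymbol{d})$ from $G$, and let $k_{\mathrm{JS}}(\boldsymbol{d})=\max_{G\in\Omega'(\boldsymbol{d})}\operatorname{dist}(G,\boldsymbol{d})$. A family $\mathcal{D}$ of graphical degree sequences is strongly stable if there is a constant $\ell$ with $k_{\mathrm{JS}}(\boldsymbol{d})\le\ell$ for all $\boldsymbol{d}\in\mathcal{D}$. *)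

theory Defs
  imports Complex_Main "HOL-Computational_Algebra.Polynomial" "HOL-Library.Extended_Nat"
begin

text \<open>A sequence of length \<open>n\<close> is a list of naturals, indexed from 0, so the vertex set is
  \<open>{0,\<dots>,n-1}\<close> and vertex \<open>i\<close> has prescribed degree \<open>d ! i\<close>. A simple graph on this fixed vertex
  set is identified with its edge set, a set of two-element sets of vertices.\<close>

definition degree_sequence :: "nat list \<Rightarrow> bool" where
  "degree_sequence d \<longleftrightarrow> even (sum_list d)"

definition simple_graph :: "nat \<Rightarrow> nat set set \<Rightarrow> bool" where
  "simple_graph n G \<longleftrightarrow> (\<forall>e\<in>G. e \<subseteq> {..<n} \<and> card e = 2)"

definition vertex_degree :: "nat set set \<Rightarrow> nat \<Rightarrow> nat" where
  "vertex_degree G v = card {e \<in> G. v \<in> e}"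

definition Omega :: "nat list \<Rightarrow> nat set set set" where
  "Omega d = {G. simple_graph (length d) G \<and> (\<forall>i<length d. vertex_degree G i = d ! i)}"

definition graphical :: "nat list \<Rightarrow> bool" where
  "graphical d \<longleftrightarrow> degree_sequence d \<and> Omega d \<noteq> {}"

definition M :: "nat list \<Rightarrow> nat" where
  "M d = sum_list d"

text \<open>The inserted 0 only serves to give the empty sequence maximum degree 0.\<close>

definition max_degree :: "nat list \<Rightarrow> nat" where
  "max_degree d = Max (insert 0 (set d))"

definition J :: "nat list \<Rightarrow> nat" where
  "J d = sum_list (take (max_degree d) (rev (sort d)))"

text \<open>Only used for lists of equal length.\<close>

definition l1_dist :: "nat list \<Rightarrow> nat list \<Rightarrow> int" where
  "l1_dist d' d = (\<Sum>j<length d. \<bar>int (d' ! j) - int (d ! j)\<bar>)"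

text \<open>Note that \<open>0 powr a = 0\<close> also for \<open>a = 0\<close>, so the bound reads \<open>0\<close> when \<open>M d = 0\<close>.\<close>

definition k_alpha_stable :: "nat \<Rightarrow> real \<Rightarrow> nat list \<Rightarrow> bool" where
  "k_alpha_stable k \<alpha> d \<longleftrightarrow> k > 0 \<and> \<alpha> \<ge> 0 \<and> graphical d \<and>
     (\<forall>d'. graphical d' \<and> length d' = length d \<and> l1_dist d' d \<le> int k \<longrightarrow>
        real (card (Omega d')) \<le> real (M d) powr \<alpha> * real (card (Omega d)))"

definition Omega' :: "nat list \<Rightarrow> nat set set set" where
  "Omega' d = (\<Union>d' \<in> {d'. graphical d' \<and> length d' = length d \<and> l1_dist d' d \<le> 2 \<and>
                           (\<forall>j<length d. d' ! j \<le> d ! j)}. Omega d')"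

definition P_stable :: "nat list set \<Rightarrow> bool" where
  "P_stable D \<longleftrightarrow> (\<exists>p :: real poly. \<forall>n>0. \<forall>d\<in>D. length d = n \<longrightarrow>
     real (card (Omega' d)) \<le> poly p (real n) * real (card (Omega d)))"

definition insertion :: "nat list \<Rightarrow> nat set set \<Rightarrow> nat set set \<Rightarrow> bool" where
  "insertion d G G' \<longleftrightarrow> (\<exists>e. e \<notin> G \<and> G' = insert e G) \<and> G' \<in> Omega d"

definition deletion :: "nat list \<Rightarrow> nat set set \<Rightarrow> nat set set \<Rightarrow> bool" where
  "deletion d G G' \<longleftrightarrow> (\<exists>e\<in>G. G' = G - {e}) \<and> G \<in> Omega d"

definition hinge_flip :: "nat list \<Rightarrow> nat set set \<Rightarrow> nat set set \<Rightarrow> bool" where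
  "hinge_flip d G G' \<longleftrightarrow>
     (\<exists>u v w. {u, v} \<in> G \<and> {w, v} \<notin> G \<and> G' = insert {w, v} (G - {{u, v}})) \<and>
     G \<notin> Omega d \<and> G' \<notin> Omega d"

text \<open>Requiring \<open>G\<close> and \<open>G'\<close> to lie in \<open>Omega' d\<close> makes both simple graphs, so the edges
  inserted above are automatically proper pairs of vertices.\<close>

definition JS_transitions :: "nat list \<Rightarrow> (nat set set \<times> nat set set) set" where
  "JS_transitions d = {(G, G'). G \<in> Omega' d \<and> G' \<in> Omega' d \<and>
     (insertion d G G' \<or> deletion d G G' \<or> hinge_flip d G G')}"

text \<open>Distances are extended naturals, so that a state from which \<open>Omega d\<close> were unreachable
  would have distance \<open>\<infinity>\<close>. The supremum in \<open>k_JS\<close> ranges over a finite set.\<close>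

definition JS_dist :: "nat set set \<Rightarrow> nat list \<Rightarrow> enat" where
  "JS_dist G d = (INF t \<in> {t. \<exists>H \<in> Omega d. (G, H) \<in> JS_transitions d ^^ t}. enat t)"

definition k_JS :: "nat list \<Rightarrow> enat" where
  "k_JS d = (SUP G \<in> Omega' d. JS_dist G d)"

definition strongly_stable :: "nat list set \<Rightarrow> bool" where
  "strongly_stable D \<longleftrightarrow> (\<forall>d\<in>D. graphical d) \<and> (\<exists>l :: nat. \<forall>d\<in>D. k_JS d \<le> enat l)"

end

theory Submission
  imports Defs
begin

text \<open>
  Everything rests on one switching. Suppose that a graph \<open>H\<close> falls short of the degrees \<open>t\<close> by one
  at \<open>a\<close> and by one at \<open>b\<close> (by two if \<open>a = b\<close>). Pick an edge \<open>xy\<close> of \<open>H\<close>, directed from \<open>x\<close> to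
  \<open>y\<close>, such that \<open>x\<close> is neither equal nor adjacent to \<open>a\<close>, and \<open>y\<close> neither equal nor adjacent to
  \<open>b\<close>; delete \<open>xy\<close>, insert \<open>ax\<close> and \<open>by\<close>. The result has degrees \<open>t\<close>. A directed edge is useless only
  if it starts in the closed neighbourhood of \<open>a\<close> or ends in that of \<open>b\<close>. For \<open>t = d\<close> such a
  neighbourhood has at most \<open>max_degree d\<close> vertices, since \<open>a\<close> has a deficit, so the degrees in
  it sum to at most \<open>J d\<close>: this is where \<open>J\<close> comes from. If \<open>t\<close> has \<open>l1\<close>-distance at most
  \<open>c\<close> from \<open>d\<close>, the bound grows only by \<open>c * max_degree d + c\<close>. Hence \<open>H\<close> has many switchable
  directed edges (\<open>card_switchable\<close>), while \<open>H\<close>, \<open>a\<close>, \<open>b\<close> and \<open>xy\<close> can be read off from the result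
  once two of its directed edges, \<open>ax\<close> and \<open>by\<close>, are marked. Counting marked results bounds the
  number of possible \<open>(H, a, b)\<close> (\<open>switching_count\<close>).

  A surplus is turned into a deficit: if a graph has one edge too many at \<open>i\<close>, delete an edge
  \<open>iu\<close>, and the deficit at \<open>u\<close> is repaired by the switching. So whenever two degree functions are
  at distance two, the numbers of their realizations are comparable (\<open>card_realizations_step\<close>).

  For stability a sequence at distance at most 8 is moved to \<open>d\<close> in at most four steps of length two,
  each at the cost of a factor \<open>(M d)\<^sup>2\<close>. An intermediate function may have sum up to
  \<open>M d + 6\<close>, which alone would make the factors slightly too large; the hypothesis on \<open>M d\<close>
  provides at least two switchable directed edges each time, and the factor 2 gained thereby
  more than compensates. The estimates compare cardinalities, so they apply to the
  intermediate functions whether or not these are graphical.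

  For P-stability, the graphs of \<open>Omega' d\<close> outside \<open>Omega d\<close> have exactly two unit deficits
  (\<open>Omega'_eq\<close>), so that one application of the counting for each pair of vertices suffices.
  For strong stability, the switching is itself a walk of the JS chain: replacing \<open>xy\<close> by
  \<open>ax\<close> is a hinge flip, and adding \<open>by\<close> is an insertion. So \<open>Omega d\<close> is always within distance 2.
\<close>

section \<open>Realizations of integer-valued degree functions\<close>

text \<open>The target degrees are integers because a deficit is expressed by subtracting indicator
  functions: the difference may be negative, and then there is simply no realization.\<close>

definition realizations :: "nat \<Rightarrow> (nat \<Rightarrow> int) \<Rightarrow> nat set set set" where
  "realizations n f = {G. simple_graph n G \<and> (\<forall>v<n. int (vertex_degree G v) = f v)}"

lemma Omega_eq_realizations: "Omega d = realizations (length d) (\<lambda>v. int (d ! v))"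
  by (auto simp: Omega_def realizations_def)

lemma realizations_cong:
  assumes "\<And>v. v < n \<Longrightarrow> f v = g v"
  shows "realizations n f = realizations n g"
  using assms by (auto simp: realizations_def)

lemma finite_simple_graph: "simple_graph n G \<Longrightarrow> finite G"
  by (rule finite_subset[of _ "Pow {..<n}"]) (auto simp: simple_graph_def)

lemma simple_graph_edge:
  assumes "simple_graph n G" "{u, v} \<in> G"
  shows "u < n" "v < n" "u \<noteq> v"
proof -
  have "{u, v} \<subseteq> {..<n}" "card {u, v} = 2"
    using assms unfolding simple_graph_def by blast+
  then show "u < n" "v < n" "u \<noteq> v" by (auto simp: card_insert_if split: if_splits)
qed

lemma finite_realizations: "finite (realizations n f)"
  by (rule finite_subset[of _ "Pow (Pow {..<n})"]) (auto simp: realizations_def simple_graph_def)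

lemma vertex_degree_insert:
  assumes "finite G" "e \<notin> G"
  shows "vertex_degree (insert e G) v = vertex_degree G v + of_bool (v \<in> e)"
proof -
  have "{x \<in> insert e G. v \<in> x} = (if v \<in> e then insert e {x \<in> G. v \<in> x} else {x \<in> G. v \<in> x})"
    by auto
  then show ?thesis using assms by (simp add: vertex_degree_def)
qed

lemma realizations_insert:
  assumes "G \<in> realizations n f" "u < n" "v < n" "u \<noteq> v" "{u, v} \<notin> G"
  shows "insert {u, v} G \<in> realizations n (\<lambda>w. f w + of_bool (w = u) + of_bool (w = v))"
  using assms finite_simple_graph[of n G]
  by (auto simp: realizations_def vertex_degree_insert simple_graph_def)

lemma realizations_delete:
  assumes "G \<in> realizations n f" "{u, v} \<in> G"
  shows "G - {{u, v}} \<in> realizations n (\<lambda>w. f w - of_bool (w = u) - of_bool (w = v))"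
proof -
  let ?G = "G - {{u, v}}"
  have G: "simple_graph n G" "\<And>w. w < n \<Longrightarrow> int (vertex_degree G w) = f w"
    using assms by (auto simp: realizations_def)
  have "u \<noteq> v" using simple_graph_edge[OF G(1) assms(2)] by simp
  have "vertex_degree G w = vertex_degree ?G w + of_bool (w \<in> {u, v})" for w
    using vertex_degree_insert[of ?G "{u, v}" w] assms(2) finite_simple_graph[OF G(1)]
    by (simp add: insert_absorb)
  then have "int (vertex_degree ?G w) = f w - of_bool (w = u) - of_bool (w = v)" if "w < n" for w
    using G(2)[OF that] \<open>u \<noteq> v\<close> by (auto simp: of_bool_def split: if_splits)
  then show ?thesis using G(1) by (auto simp: realizations_def simple_graph_def)
qed

section \<open>Counting darts\<close>

text \<open>A dart is an edge together with one of its two directions.\<close>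

definition darts :: "nat set set \<Rightarrow> (nat \<times> nat) set" where
  "darts G = {(x, y). {x, y} \<in> G}"

lemma darts_subset: "simple_graph n G \<Longrightarrow> darts G \<subseteq> {..<n} \<times> {..<n}"
  using simple_graph_edge by (fastforce simp: darts_def)

lemma finite_darts: "simple_graph n G \<Longrightarrow> finite (darts G)"
  using darts_subset finite_subset by blast

lemma vertex_degree_eq_card_neighbours:
  assumes "simple_graph n G"
  shows "vertex_degree G v = card {y. {v, y} \<in> G}"
proof -
  have "\<exists>y. e = {v, y}" if "e \<in> G" "v \<in> e" for e
  proof -
    have "card e = 2" using assms that by (auto simp: simple_graph_def)
    then show ?thesis using that(2) by (auto simp: card_2_iff)
  qed
  then have "bij_betw (\<lambda>y. {v, y}) {y. {v, y} \<in> G} {e \<in> G. v \<in> e}"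
    by (auto simp: bij_betw_def inj_on_def doubleton_eq_iff)
  then show ?thesis by (simp add: vertex_degree_def bij_betw_same_card)
qed

lemma card_darts_from:
  assumes "simple_graph n G" "finite S"
  shows "card {(x, y) \<in> darts G. x \<in> S} = (\<Sum>x\<in>S. vertex_degree G x)"
proof -
  have fin: "finite {y. {x, y} \<in> G}" for x
    by (rule finite_subset[of _ "{..<n}"]) (use simple_graph_edge[OF assms(1)] in auto)
  have "{(x, y) \<in> darts G. x \<in> S} = (SIGMA x:S. {y. {x, y} \<in> G})"
    by (auto simp: darts_def)
  then show ?thesis
    using assms fin by (simp add: vertex_degree_eq_card_neighbours)
qed

lemma card_darts:
  assumes "G \<in> realizations n f"
  shows "int (card (darts G)) = (\<Sum>v<n. f v)"
proof -
  have G: "simple_graph n G" using assms by (simp add: realizations_def)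
  have "darts G = {(x, y) \<in> darts G. x \<in> {..<n}}" using darts_subset[OF G] by auto
  then have "card (darts G) = (\<Sum>v<n. vertex_degree G v)"
    using card_darts_from[OF G, of "{..<n}"] by simp
  then show ?thesis using assms by (simp add: realizations_def)
qed

section \<open>Sums of large entries\<close>

lemma M_eq_sum: "int (M d) = (\<Sum>v<length d. int (d ! v))"
  by (simp add: M_def sum_list_sum_nth atLeast0LessThan)

lemma entry_le_max_degree: "v < length d \<Longrightarrow> d ! v \<le> max_degree d"
  by (auto simp: max_degree_def)

text \<open>Cut all entries at the height \<open>\<theta>\<close> of the \<open>k\<close>-th largest one: \<open>k\<close> entries have at most
  \<open>k * \<theta>\<close> below the cut, and above the cut at most what all entries together have there, which is
  what the \<open>k\<close> largest ones have there.\<close>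

lemma sum_le_sum_largest:
  fixes d :: "nat list"
  assumes S: "S \<subseteq> {..<length d}" and card: "card S \<le> k"
  shows "(\<Sum>v\<in>S. d ! v) \<le> sum_list (take k (rev (sort d)))"
proof -
  define ys where "ys = rev (sort d)"
  have mset: "mset ys = mset d" by (simp add: ys_def)
  have len: "length ys = length d" by (simp add: ys_def)
  have fin: "finite S" using S finite_subset by blast
  have sum_all: "(\<Sum>v<length d. g (d ! v)) = sum_list (map g ys)" for g :: "nat \<Rightarrow> nat"
  proof -
    have "(\<Sum>v<length d. g (d ! v)) = sum_list (map g d)"
      by (simp add: sum_list_sum_nth atLeast0LessThan)
    also have "\<dots> = sum_list (map g ys)"
      by (metis mset mset_map sum_mset_sum_list)
    finally show ?thesis .
  qed
  show ?thesis
  proof (cases "k \<ge> length d \<or> k = 0")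
    case True
    then consider "k \<ge> length d" | "k = 0" by blast
    then show ?thesis
    proof cases
      case 1
      have "(\<Sum>v\<in>S. d ! v) \<le> (\<Sum>v<length d. d ! v)"
        using S by (intro sum_mono2) auto
      also have "\<dots> = sum_list (take k ys)" using sum_all[of "\<lambda>x. x"] 1 len by simp
      finally show ?thesis by (simp add: ys_def)
    next
      case 2
      then show ?thesis using card fin by simp
    qed
  next
    case False
    then have k: "0 < k" "k < length ys" using len by auto
    define \<theta> where "\<theta> = ys ! (k - 1)"
    have desc: "ys ! j \<le> ys ! i" if "i \<le> j" "j < length ys" for i j
      using that sorted_nth_mono[OF sorted_sort[of d], of "length d - Suc j" "length d - Suc i"]
      by (auto simp: ys_def rev_nth)
    have hi: "\<theta> \<le> y" if "y \<in> set (take k ys)" for y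
      using that desc k by (auto simp: in_set_conv_nth \<theta>_def)
    have lo: "y \<le> \<theta>" if "y \<in> set (drop k ys)" for y
      using that desc k by (auto simp: in_set_conv_nth \<theta>_def)
    have "(\<Sum>v\<in>S. d ! v) \<le> (\<Sum>v\<in>S. \<theta> + (d ! v - \<theta>))" by (intro sum_mono) auto
    also have "\<dots> \<le> k * \<theta> + (\<Sum>v\<in>S. d ! v - \<theta>)" using card by (simp add: sum.distrib)
    also have "(\<Sum>v\<in>S. d ! v - \<theta>) \<le> (\<Sum>v<length d. d ! v - \<theta>)"
      using S by (intro sum_mono2) auto
    also have "\<dots> = sum_list (map (\<lambda>y. y - \<theta>) (take k ys @ drop k ys))"
      using sum_all[of "\<lambda>y. y - \<theta>"] by simp
    also have "\<dots> = sum_list (map (\<lambda>y. y - \<theta>) (take k ys))"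
      unfolding map_append sum_list_append using lo by (auto intro!: sum_list_0)
    also have "k * \<theta> + \<dots> = sum_list (map (\<lambda>y. \<theta> + (y - \<theta>)) (take k ys))"
      using k by (simp add: sum_list_addf sum_list_triv)
    also have "\<dots> = sum_list (take k ys)"
      using hi by (intro arg_cong[of _ _ sum_list] map_idI) auto
    finally show ?thesis by (simp add: ys_def)
  qed
qed

text \<open>The entries of \<open>S\<close> beyond the first \<open>max_degree d\<close> are bounded by \<open>max_degree d\<close> each.\<close>

lemma sum_le_J:
  assumes S: "S \<subseteq> {..<length d}" and card: "card S \<le> max_degree d + c"
  shows "(\<Sum>v\<in>S. d ! v) \<le> J d + c * max_degree d"
proof -
  have fin: "finite S" using S finite_subset by blast
  obtain T where T: "T \<subseteq> S" "card T = min (max_degree d) (card S)"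
    using obtain_subset_with_card_n[of "min (max_degree d) (card S)" S] by auto
  have "(\<Sum>v\<in>S. d ! v) = (\<Sum>v\<in>T. d ! v) + (\<Sum>v\<in>S - T. d ! v)"
    using sum.subset_diff[OF T(1) fin, of "(!) d"] by simp
  also have "(\<Sum>v\<in>T. d ! v) \<le> J d"
    unfolding J_def using T S by (intro sum_le_sum_largest) auto
  also have "(\<Sum>v\<in>S - T. d ! v) \<le> card (S - T) * max_degree d"
    using S entry_le_max_degree by (intro order.trans[OF sum_bounded_above]) auto
  also have "card (S - T) \<le> c"
    using T card fin by (simp add: card_Diff_subset finite_subset min_def split: if_splits)
  finally show ?thesis by simp
qed

definition deviation :: "nat list \<Rightarrow> (nat \<Rightarrow> int) \<Rightarrow> int" where
  "deviation d f = (\<Sum>v<length d. \<bar>f v - int (d ! v)\<bar>)"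

lemma deviation_nonpos:
  assumes "deviation d f \<le> 0" "v < length d"
  shows "f v = int (d ! v)"
proof -
  have "deviation d f = 0" using assms(1) unfolding deviation_def by (intro antisym sum_nonneg) auto
  then have "\<bar>f v - int (d ! v)\<bar> = 0"
    unfolding deviation_def using assms(2) by (subst (asm) sum_nonneg_eq_0_iff) auto
  then show ?thesis by simp
qed

section \<open>The switching\<close>

definition switchable :: "nat set set \<Rightarrow> nat \<Rightarrow> nat \<Rightarrow> (nat \<times> nat) set" where
  "switchable H a b = {(x, y) \<in> darts H. x \<noteq> a \<and> {a, x} \<notin> H \<and> y \<noteq> b \<and> {b, y} \<notin> H}"

definition switch :: "nat set set \<Rightarrow> nat \<Rightarrow> nat \<Rightarrow> nat \<Rightarrow> nat \<Rightarrow> nat set set" where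
  "switch H a b x y = insert {b, y} (insert {a, x} (H - {{x, y}}))"

text \<open>If \<open>ax\<close> and \<open>by\<close> were the same edge, the switch would insert one edge only. The case \<open>a = y\<close>
  is excluded because \<open>ax\<close> would be the edge \<open>xy\<close> of \<open>H\<close>.\<close>

lemma switchable_new_edges_distinct:
  assumes simple: "simple_graph n H" and xy: "(x, y) \<in> switchable H a b"
  shows "{a, x} \<noteq> {b, y}"
proof
  have H: "{x, y} \<in> H" "{a, x} \<notin> H" using xy by (auto simp: switchable_def darts_def)
  assume "{a, x} = {b, y}"
  then consider "x = y" | "a = y" by (auto simp: doubleton_eq_iff)
  then show False
  proof cases
    case 1
    then show ?thesis using simple_graph_edge(3)[OF simple H(1)] by simp
  next
    case 2
    then show ?thesis using H by (simp add: insert_commute)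
  qed
qed

text \<open>Half of the switch is a hinge flip that moves the deficit from \<open>a\<close> to \<open>y\<close>.\<close>

lemma hinge_realizes:
  assumes H: "H \<in> realizations n (\<lambda>v. t v - of_bool (v = a) - of_bool (v = b))"
    and "a < n" and xy: "(x, y) \<in> switchable H a b"
  shows "insert {a, x} (H - {{x, y}}) \<in> realizations n (\<lambda>v. t v - of_bool (v = b) - of_bool (v = y))"
proof -
  have "simple_graph n H" "{x, y} \<in> H" using H xy by (auto simp: realizations_def switchable_def darts_def)
  note e = simple_graph_edge[OF this]
  have "insert {a, x} (H - {{x, y}}) \<in> realizations n (\<lambda>v. t v - of_bool (v = a) - of_bool (v = b)
      - of_bool (v = x) - of_bool (v = y) + of_bool (v = a) + of_bool (v = x))"
    using realizations_insert[OF realizations_delete[OF H \<open>{x, y} \<in> H\<close>] \<open>a < n\<close> e(1)] xy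
    by (auto simp: switchable_def)
  then show ?thesis by (rule back_subst) (auto intro!: realizations_cong)
qed

lemma switch_realizes:
  assumes H: "H \<in> realizations n (\<lambda>v. t v - of_bool (v = a) - of_bool (v = b))"
    and "a < n" "b < n" and xy: "(x, y) \<in> switchable H a b"
  shows "switch H a b x y \<in> realizations n t"
proof -
  have "simple_graph n H" "{x, y} \<in> H" using H xy by (auto simp: realizations_def switchable_def darts_def)
  note e = simple_graph_edge[OF this]
  have "switch H a b x y \<in> realizations n (\<lambda>v. t v - of_bool (v = b) - of_bool (v = y)
      + of_bool (v = b) + of_bool (v = y))"
    unfolding switch_def
    using realizations_insert[OF hinge_realizes[OF H \<open>a < n\<close> xy] \<open>b < n\<close> e(2)]
      xy switchable_new_edges_distinct[OF \<open>simple_graph n H\<close> xy]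
    by (auto simp: switchable_def)
  then show ?thesis by (rule back_subst) (auto intro!: realizations_cong)
qed

lemma switch_inverse:
  assumes "(x, y) \<in> switchable H a b"
  shows "H = insert {x, y} (switch H a b x y - {{a, x}, {b, y}})"
  using assms by (auto simp: switch_def switchable_def darts_def)

text \<open>The deficit of \<open>h\<close> at \<open>a\<close> pays for counting \<open>a\<close> itself: the closed neighbourhood has
  \<open>h a + 1 \<le> t a \<le> max_degree d + c\<close> vertices.\<close>

lemma darts_from_closed_neighbourhood:
  assumes G: "G \<in> realizations (length d) h" and a: "a < length d"
    and le: "\<And>v. v < length d \<Longrightarrow> h v \<le> t v" and less: "h a < t a"
    and dev: "deviation d t \<le> int c"
  shows "card {(x, y) \<in> darts G. x = a \<or> {a, x} \<in> G} \<le> J d + c * max_degree d + c"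
proof -
  define S where "S = insert a {x. {a, x} \<in> G}"
  have simple: "simple_graph (length d) G" using G by (simp add: realizations_def)
  have S: "S \<subseteq> {..<length d}" using simple_graph_edge[OF simple] a by (auto simp: S_def)
  then have fin: "finite S" using finite_subset by blast
  have dev_S: "(\<Sum>v\<in>T. \<bar>t v - int (d ! v)\<bar>) \<le> int c" if "T \<subseteq> {..<length d}" for T
    using that dev unfolding deviation_def
    by (intro order.trans[OF sum_mono2[of "{..<length d}" T]]) auto
  have "card S \<le> Suc (vertex_degree G a)"
    using fin by (simp add: S_def vertex_degree_eq_card_neighbours[OF simple] card_insert_if)
  then have "int (card S) \<le> h a + 1" using G a by (auto simp: realizations_def)
  also have "\<dots> \<le> t a" using less by simp
  also have "t a \<le> int (d ! a) + int c" using dev_S[of "{a}"] a by simp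
  also have "\<dots> \<le> int (max_degree d + c)" using entry_le_max_degree[OF a] by simp
  finally have card: "card S \<le> max_degree d + c" by linarith
  have "{(x, y) \<in> darts G. x = a \<or> {a, x} \<in> G} = {(x, y) \<in> darts G. x \<in> S}" by (auto simp: S_def)
  then have "int (card {(x, y) \<in> darts G. x = a \<or> {a, x} \<in> G}) = (\<Sum>v\<in>S. h v)"
    using card_darts_from[OF simple fin] G S by (auto simp: realizations_def intro!: sum.cong)
  also have "\<dots> \<le> (\<Sum>v\<in>S. int (d ! v) + \<bar>t v - int (d ! v)\<bar>)"
    using S le by (intro sum_mono) force
  also have "\<dots> \<le> int (\<Sum>v\<in>S. d ! v) + int c" using dev_S[OF S] by (simp add: sum.distrib)
  also have "\<dots> \<le> int (J d + c * max_degree d + c)" using sum_le_J[OF S card]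
    unfolding of_nat_add[symmetric] of_nat_le_iff by simp
  finally show ?thesis by linarith
qed

text \<open>Of the darts of \<open>H\<close>, at least \<open>M d - c - 2\<close> in number, those that are not switchable start in
  the closed neighbourhood of \<open>a\<close> or are the reverse of one that starts in that of \<open>b\<close>.\<close>

lemma card_switchable:
  assumes H: "H \<in> realizations (length d) (\<lambda>v. t v - of_bool (v = a) - of_bool (v = b))"
    and a: "a < length d" and b: "b < length d" and dev: "deviation d t \<le> int c"
  shows "M d \<le> card (switchable H a b) + 2 * J d + 2 * c * max_degree d + 3 * c + 2"
proof -
  let ?A = "{(x, y) \<in> darts H. x = a \<or> {a, x} \<in> H}"
  let ?B = "{(x, y) \<in> darts H. x = b \<or> {b, x} \<in> H}"
  have simple: "simple_graph (length d) H" using H by (simp add: realizations_def)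
  note fin = finite_darts[OF simple]
  have "card (darts H) \<le> card (switchable H a b \<union> (?A \<union> prod.swap ` ?B))"
  proof (rule card_mono)
    show "finite (switchable H a b \<union> (?A \<union> prod.swap ` ?B))"
      using fin by (auto simp: switchable_def intro: finite_subset[of _ "darts H"])
    have "p \<in> switchable H a b \<union> (?A \<union> prod.swap ` ?B)" if "p \<in> darts H" for p
    proof (cases p)
      case (Pair x y)
      then have "(y, x) \<in> darts H" using that by (simp add: darts_def insert_commute)
      then have "y = b \<or> {b, y} \<in> H \<Longrightarrow> (x, y) \<in> prod.swap ` ?B"
        by (intro image_eqI[of _ _ "(y, x)"]) auto
      then show ?thesis using that Pair by (auto simp: switchable_def)
    qed
    then show "darts H \<subseteq> switchable H a b \<union> (?A \<union> prod.swap ` ?B)" by blast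
  qed
  also have "\<dots> \<le> card (switchable H a b) + (card ?A + card (prod.swap ` ?B))"
    by (intro order.trans[OF card_Un_le] add_left_mono card_Un_le)
  also have "card (prod.swap ` ?B) = card ?B" by (intro card_image inj_onI) auto
  also have "card ?A \<le> J d + c * max_degree d + c"
    by (rule darts_from_closed_neighbourhood[OF H a _ _ dev]) auto
  also have "card ?B \<le> J d + c * max_degree d + c"
    by (rule darts_from_closed_neighbourhood[OF H b _ _ dev]) auto
  finally have "card (darts H) \<le> card (switchable H a b) + 2 * J d + 2 * c * max_degree d + 2 * c"
    by (simp add: algebra_simps)
  moreover have "int (M d) - int c - 2 \<le> int (card (darts H))"
  proof -
    have "int (M d) = (\<Sum>v<length d. int (d ! v))" by (rule M_eq_sum)
    also have "\<dots> \<le> (\<Sum>v<length d. t v + \<bar>t v - int (d ! v)\<bar>)" by (intro sum_mono) auto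
    also have "\<dots> \<le> (\<Sum>v<length d. t v) + int c" using dev by (simp add: deviation_def sum.distrib)
    finally have "int (M d) - int c \<le> (\<Sum>v<length d. t v)" by simp
    moreover have "int (card (darts H)) = (\<Sum>v<length d. t v) - 2"
      using card_darts[OF H] a b by (simp add: sum_subtractf of_bool_def)
    ultimately show ?thesis by simp
  qed
  ultimately show ?thesis by linarith
qed

text \<open>Double counting. An object \<open>\<alpha>\<close> together with a switchable dart \<open>(x, y)\<close> is sent to the
  switched graph with the marked darts \<open>(a, x)\<close> and \<open>(b, y)\<close>. The marks give back all four vertices, so
  the switch can be undone and \<open>\<alpha>\<close> recovered. The index type is left open because \<open>\<alpha>\<close> will be
  a graph from which \<open>H\<close>, \<open>a\<close> and \<open>b\<close> are obtained by removing surplus edges.\<close>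

lemma switching_count:
  fixes H :: "'a \<Rightarrow> nat set set"
  assumes fin: "finite A"
    and H: "\<And>\<alpha>. \<alpha> \<in> A \<Longrightarrow> H \<alpha> \<in> realizations n (\<lambda>v. t v - of_bool (v = a \<alpha>) - of_bool (v = b \<alpha>))"
    and ab: "\<And>\<alpha>. \<alpha> \<in> A \<Longrightarrow> a \<alpha> < n \<and> b \<alpha> < n"
    and inj: "inj_on (\<lambda>\<alpha>. (H \<alpha>, a \<alpha>, b \<alpha>)) A"
    and many: "\<And>\<alpha>. \<alpha> \<in> A \<Longrightarrow> p \<le> card (switchable (H \<alpha>) (a \<alpha>) (b \<alpha>))"
    and few: "\<And>G. G \<in> realizations n t \<Longrightarrow> card (darts G) \<le> m"
  shows "p * card A \<le> m\<^sup>2 * card (realizations n t)"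
proof -
  define F where "F \<alpha> = switchable (H \<alpha>) (a \<alpha>) (b \<alpha>)" for \<alpha>
  define \<Phi> where "\<Phi> = (\<lambda>(\<alpha>, x, y). (switch (H \<alpha>) (a \<alpha>) (b \<alpha>) x y, (a \<alpha>, x), (b \<alpha>, y)))"
  let ?R = "realizations n t"
  have finF: "finite (F \<alpha>)" if "\<alpha> \<in> A" for \<alpha>
    using finite_darts[of n "H \<alpha>"] H[OF that] unfolding F_def switchable_def realizations_def
    by (auto intro: finite_subset)
  have finD: "finite (darts G)" if "G \<in> ?R" for G
    using finite_darts that by (auto simp: realizations_def)
  have "inj_on \<Phi> (Sigma A F)"
  proof (rule inj_onI)
    fix z z' assume z: "z \<in> Sigma A F" "z' \<in> Sigma A F" and eq: "\<Phi> z = \<Phi> z'"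
    obtain \<alpha> x y where \<alpha>: "z = (\<alpha>, x, y)" "(x, y) \<in> F \<alpha>" "\<alpha> \<in> A" using z(1) by auto
    obtain \<beta> x' y' where \<beta>: "z' = (\<beta>, x', y')" "(x', y') \<in> F \<beta>" "\<beta> \<in> A" using z(2) by auto
    have same: "switch (H \<alpha>) (a \<alpha>) (b \<alpha>) x y = switch (H \<beta>) (a \<beta>) (b \<beta>) x' y' \<and>
      (a \<alpha> = a \<beta> \<and> x = x') \<and> b \<alpha> = b \<beta> \<and> y = y'"
      using eq unfolding \<alpha>(1) \<beta>(1) \<Phi>_def prod.case prod.inject .
    have "H \<alpha> = H \<beta>"
      using switch_inverse[of x y "H \<alpha>" "a \<alpha>" "b \<alpha>"] switch_inverse[of x' y' "H \<beta>" "a \<beta>" "b \<beta>"]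
        \<alpha>(2) \<beta>(2) same unfolding F_def by metis
    then have "\<alpha> = \<beta>" using inj_onD[OF inj _ \<alpha>(3) \<beta>(3)] same by simp
    then show "z = z'" using same \<alpha>(1) \<beta>(1) by simp
  qed
  moreover have "\<Phi> ` Sigma A F \<subseteq> (SIGMA G:?R. darts G \<times> darts G)"
  proof (rule image_subsetI)
    fix z assume "z \<in> Sigma A F"
    then obtain \<alpha> x y where z: "z = (\<alpha>, x, y)" "\<alpha> \<in> A" "(x, y) \<in> switchable (H \<alpha>) (a \<alpha>) (b \<alpha>)"
      by (auto simp: F_def)
    then have "switch (H \<alpha>) (a \<alpha>) (b \<alpha>) x y \<in> ?R" using switch_realizes[OF H] ab by blast
    then show "\<Phi> z \<in> (SIGMA G:?R. darts G \<times> darts G)"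
      by (simp add: z(1) \<Phi>_def) (simp add: darts_def switch_def)
  qed
  moreover have "finite (SIGMA G:?R. darts G \<times> darts G)"
    using finite_realizations finD by (intro finite_SigmaI) auto
  ultimately have "card (Sigma A F) \<le> card (SIGMA G:?R. darts G \<times> darts G)"
    by (rule card_inj_on_le)
  also have "\<dots> = (\<Sum>G\<in>?R. card (darts G) * card (darts G))"
    using finite_realizations finD by (simp add: card_cartesian_product)
  also have "\<dots> \<le> (\<Sum>G\<in>?R. m\<^sup>2)"
    using few by (intro sum_mono) (simp add: power2_eq_square mult_mono)
  finally have "card (Sigma A F) \<le> m\<^sup>2 * card ?R" by (simp add: mult.commute)
  moreover have "p * card A \<le> card (Sigma A F)"
  proof -
    have "p * card A = (\<Sum>\<alpha>\<in>A. p)" by simp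
    also have "\<dots> \<le> (\<Sum>\<alpha>\<in>A. card (F \<alpha>))" using many by (intro sum_mono) (simp add: F_def)
    also have "\<dots> = card (Sigma A F)" using fin finF by simp
    finally show ?thesis .
  qed
  ultimately show ?thesis by simp
qed

section \<open>One step of distance two\<close>

lemma exists_neighbour:
  assumes "simple_graph n G" "0 < vertex_degree G v"
  shows "\<exists>u. {v, u} \<in> G"
  using assms by (auto simp: vertex_degree_eq_card_neighbours card_gt_0_iff)

text \<open>Two surpluses are removed by deleting two different edges. This could fail if \<open>ij\<close> were the only
  edge at \<open>i\<close> and at \<open>j\<close>. If \<open>i = j\<close>, the set \<open>{i, j}\<close> is a singleton and never an edge, so this
  case is covered.\<close>

lemma exists_distinct_incident_edges:
  assumes G: "G \<in> realizations n (\<lambda>v. t v + of_bool (v = i) + of_bool (v = j))"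
    and nonneg: "\<And>v. v < n \<Longrightarrow> 0 \<le> t v" and ij: "i < n" "j < n" "{i, j} \<notin> G"
  shows "\<exists>u v. {i, u} \<in> G \<and> {j, v} \<in> G \<and> {i, u} \<noteq> {j, v}"
proof -
  have simple: "simple_graph n G" using G by (simp add: realizations_def)
  have deg: "int (vertex_degree G w) = t w + of_bool (w = i) + of_bool (w = j)" if "w < n" for w
    using G that by (simp add: realizations_def)
  show ?thesis
  proof (cases "i = j")
    case True
    have "2 \<le> vertex_degree G i" using deg[OF ij(1)] nonneg[OF ij(1)] True by simp
    then have "2 \<le> card {y. {i, y} \<in> G}" by (simp add: vertex_degree_eq_card_neighbours[OF simple])
    then obtain T where "T \<subseteq> {y. {i, y} \<in> G}" "card T = 2"
      by (meson obtain_subset_with_card_n)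
    then obtain u v where "{i, u} \<in> G" "{i, v} \<in> G" "u \<noteq> v" by (auto simp: card_2_iff)
    then show ?thesis using True by (auto simp: doubleton_eq_iff)
  next
    case False
    have "0 < vertex_degree G i" "0 < vertex_degree G j"
      using deg[OF ij(1)] deg[OF ij(2)] nonneg[OF ij(1)] nonneg[OF ij(2)] False by auto
    then obtain u v where uv: "{i, u} \<in> G" "{j, v} \<in> G" using exists_neighbour[OF simple] by blast
    then have "{i, u} \<noteq> {j, v}" using ij(3) False by (auto simp: doubleton_eq_iff)
    then show ?thesis using uv by blast
  qed
qed

lemma card_realizations_two_deficits:
  assumes "\<And>H a b. a < n \<Longrightarrow> b < n \<Longrightarrow>
      H \<in> realizations n (\<lambda>v. t v - of_bool (v = a) - of_bool (v = b)) \<Longrightarrow> p \<le> card (switchable H a b)"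
    and "\<And>G. G \<in> realizations n t \<Longrightarrow> card (darts G) \<le> m"
    and "i < n" "j < n"
  shows "p * card (realizations n (\<lambda>v. t v - of_bool (v = i) - of_bool (v = j)))
    \<le> m\<^sup>2 * card (realizations n t)"
  using assms
  by (intro switching_count[where H = "\<lambda>G. G" and a = "\<lambda>_. i" and b = "\<lambda>_. j"])
    (auto simp: finite_realizations inj_on_def)

text \<open>Deleting an edge from \<open>i\<close> to some neighbour \<open>u\<close> leaves deficits at \<open>u\<close> and \<open>j\<close>; knowing
  \<open>u\<close>, the edge can be put back.\<close>

lemma card_realizations_surplus_deficit:
  assumes many: "\<And>H a b. a < n \<Longrightarrow> b < n \<Longrightarrow>
      H \<in> realizations n (\<lambda>v. t v - of_bool (v = a) - of_bool (v = b)) \<Longrightarrow> p \<le> card (switchable H a b)"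
    and few: "\<And>G. G \<in> realizations n t \<Longrightarrow> card (darts G) \<le> m"
    and nonneg: "\<And>v. v < n \<Longrightarrow> 0 \<le> t v" and ij: "i < n" "j < n" "i \<noteq> j"
  shows "p * card (realizations n (\<lambda>v. t v + of_bool (v = i) - of_bool (v = j)))
    \<le> m\<^sup>2 * card (realizations n t)"
proof -
  let ?A = "realizations n (\<lambda>v. t v + of_bool (v = i) - of_bool (v = j))"
  define u where "u G = (SOME u. {i, u} \<in> G)" for G
  have simple: "simple_graph n G" if "G \<in> ?A" for G using that by (simp add: realizations_def)
  have u: "{i, u G} \<in> G" if "G \<in> ?A" for G
  proof -
    have "int (vertex_degree G i) = t i + 1" using that ij by (simp add: realizations_def)
    then have "0 < vertex_degree G i" using nonneg[OF ij(1)] by simp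
    then show ?thesis unfolding u_def by (rule someI_ex[OF exists_neighbour[OF simple[OF that]]])
  qed
  have H: "G - {{i, u G}} \<in> realizations n (\<lambda>v. t v - of_bool (v = u G) - of_bool (v = j))"
    if "G \<in> ?A" for G
    using realizations_delete[OF that u[OF that]]
    by (rule back_subst) (auto intro!: realizations_cong)
  have lt: "u G < n" if "G \<in> ?A" for G using simple_graph_edge(2)[OF simple[OF that] u[OF that]] .
  show ?thesis
  proof (rule switching_count[where H = "\<lambda>G. G - {{i, u G}}" and a = u and b = "\<lambda>_. j"])
    show "inj_on (\<lambda>G. (G - {{i, u G}}, u G, j)) ?A"
      by (rule inj_on_inverseI[where g = "\<lambda>(H, u, _). insert {i, u} H"]) (use u in auto)
  qed (use H lt few many ij finite_realizations in auto)
qed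

text \<open>The graphs containing the edge \<open>ij\<close> are mapped injectively to realizations of \<open>t\<close> by deleting it, which
  accounts for the additional \<open>p\<close>. In the others, deleting an edge \<open>iu\<close> and another edge \<open>jv\<close>
  leaves deficits at \<open>u\<close> and \<open>v\<close>.\<close>

lemma card_realizations_two_surpluses:
  assumes many: "\<And>H a b. a < n \<Longrightarrow> b < n \<Longrightarrow>
      H \<in> realizations n (\<lambda>v. t v - of_bool (v = a) - of_bool (v = b)) \<Longrightarrow> p \<le> card (switchable H a b)"
    and few: "\<And>G. G \<in> realizations n t \<Longrightarrow> card (darts G) \<le> m"
    and nonneg: "\<And>v. v < n \<Longrightarrow> 0 \<le> t v" and ij: "i < n" "j < n"
  shows "p * card (realizations n (\<lambda>v. t v + of_bool (v = i) + of_bool (v = j)))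
    \<le> (m\<^sup>2 + p) * card (realizations n t)"
proof -
  let ?A = "realizations n (\<lambda>v. t v + of_bool (v = i) + of_bool (v = j))"
  let ?A1 = "{G \<in> ?A. {i, j} \<in> G}" and ?A2 = "{G \<in> ?A. {i, j} \<notin> G}"
  have fin: "finite ?A" by (rule finite_realizations)
  have simple: "simple_graph n G" if "G \<in> ?A" for G using that by (simp add: realizations_def)
  have "card ?A1 \<le> card (realizations n t)"
  proof (rule card_inj_on_le[where f = "\<lambda>G. G - {{i, j}}"])
    show "inj_on (\<lambda>G. G - {{i, j}}) ?A1"
      by (rule inj_on_inverseI[where g = "insert {i, j}"]) auto
    show "(\<lambda>G. G - {{i, j}}) ` ?A1 \<subseteq> realizations n t"
    proof clarify
      fix G assume "G \<in> ?A" "{i, j} \<in> G"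
      from realizations_delete[OF this] show "G - {{i, j}} \<in> realizations n t"
        by (rule back_subst) (auto intro!: realizations_cong)
    qed
  qed (rule finite_realizations)
  moreover have "p * card ?A2 \<le> m\<^sup>2 * card (realizations n t)"
  proof -
    define uv where "uv G = (SOME p. {i, fst p} \<in> G \<and> {j, snd p} \<in> G \<and> {i, fst p} \<noteq> {j, snd p})" for G
    define u v where "u G = fst (uv G)" and "v G = snd (uv G)" for G
    define H where "H G = G - {{i, u G}} - {{j, v G}}" for G
    have uv: "{i, u G} \<in> G" "{j, v G} \<in> G" "{i, u G} \<noteq> {j, v G}" if "G \<in> ?A2" for G
    proof -
      have "\<exists>p. {i, fst p} \<in> G \<and> {j, snd p} \<in> G \<and> {i, fst p} \<noteq> {j, snd p}"
        using exists_distinct_incident_edges[of G n t i j] nonneg ij that by simp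
      from someI_ex[OF this] show "{i, u G} \<in> G" "{j, v G} \<in> G" "{i, u G} \<noteq> {j, v G}"
        unfolding u_def v_def uv_def by blast+
    qed
    have H: "H G \<in> realizations n (\<lambda>w. t w - of_bool (w = u G) - of_bool (w = v G))"
      if "G \<in> ?A2" for G
    proof -
      have G: "G \<in> ?A" using that by simp
      have "{j, v G} \<in> G - {{i, u G}}" using uv[OF that] by auto
      from realizations_delete[OF realizations_delete[OF G uv(1)[OF that]] this]
      show ?thesis unfolding H_def by (rule back_subst) (auto intro!: realizations_cong)
    qed
    have lt: "u G < n" "v G < n" if "G \<in> ?A2" for G
      using simple_graph_edge(2)[OF simple uv(1)] simple_graph_edge(2)[OF simple uv(2)] that by auto
    show ?thesis
    proof (rule switching_count[where H = H and a = u and b = v])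
      show "inj_on (\<lambda>G. (H G, u G, v G)) ?A2"
        by (rule inj_on_inverseI[where g = "\<lambda>(H, u, v). insert {i, u} (insert {j, v} H)"])
          (use uv in \<open>auto simp: H_def\<close>)
    qed (use H lt few many fin in auto)
  qed
  moreover have "card ?A = card ?A1 + card ?A2"
    using fin by (subst card_Un_disjoint[symmetric]) (auto intro: arg_cong[of _ _ card])
  ultimately show ?thesis by (simp add: algebra_simps) (meson add_mono mult_le_mono2)
qed

text \<open>Realizations of \<open>t\<close> have at most \<open>M d + 6\<close> darts, and the graphs to be switched have at least
  two switchable darts, so the ratio is at most \<open>((M d + 6)\<^sup>2 + 2) / 2\<close>. This is at most
  \<open>(M d)\<^sup>2\<close> because \<open>M d \<ge> 57\<close>.\<close>

lemma card_realizations_step: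
  assumes large: "2 * J d + 18 * max_degree d + 56 < M d"
    and nonneg: "\<And>v. v < length d \<Longrightarrow> 0 \<le> t v" and dev: "deviation d t \<le> 6"
    and ij: "i < length d" "j < length d" and s: "s \<in> {1, -1}" "s' \<in> {1, -1}"
  shows "card (realizations (length d) (\<lambda>v. t v + s * of_bool (v = i) + s' * of_bool (v = j)))
    \<le> (M d)\<^sup>2 * card (realizations (length d) t)"
proof -
  let ?n = "length d" and ?R = "card (realizations (length d) t)"
  have many: "2 \<le> card (switchable H a b)"
    if "a < ?n" "b < ?n" "H \<in> realizations ?n (\<lambda>v. t v - of_bool (v = a) - of_bool (v = b))" for H a b
    using card_switchable[OF that(3,1,2), of 6] dev large by simp
  have few: "card (darts G) \<le> M d + 6" if "G \<in> realizations ?n t" for G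
  proof -
    have "(\<Sum>v<?n. t v) \<le> (\<Sum>v<?n. int (d ! v) + \<bar>t v - int (d ! v)\<bar>)" by (intro sum_mono) auto
    also have "\<dots> \<le> int (M d) + 6" using dev by (simp add: deviation_def sum.distrib M_eq_sum)
    finally show ?thesis using card_darts[OF that] by simp
  qed
  have "57 * M d \<le> M d * M d" using large by (intro mult_right_mono) auto
  moreover have "(M d + 6) * (M d + 6) + 2 = M d * M d + 12 * M d + 38" by (simp add: algebra_simps)
  ultimately have M: "(M d + 6)\<^sup>2 + 2 \<le> 2 * (M d)\<^sup>2"
    using large unfolding power2_eq_square by linarith
  have *: "card X \<le> (M d)\<^sup>2 * ?R" if "2 * card X \<le> ((M d + 6)\<^sup>2 + 2) * ?R" for X :: "nat set set set"
  proof -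
    have "2 * card X \<le> 2 * (M d)\<^sup>2 * ?R" using that mult_right_mono[OF M, of ?R] by simp
    then show ?thesis by simp
  qed
  have surpluses: "2 * card (realizations ?n (\<lambda>v. t v + of_bool (v = i) + of_bool (v = j)))
      \<le> ((M d + 6)\<^sup>2 + 2) * ?R"
    by (rule card_realizations_two_surpluses[OF many few nonneg ij])
  have deficits: "2 * card (realizations ?n (\<lambda>v. t v - of_bool (v = i) - of_bool (v = j)))
      \<le> (M d + 6)\<^sup>2 * ?R"
    by (rule card_realizations_two_deficits[OF many few ij])
  have mixed: "2 * card (realizations ?n (\<lambda>v. t v + of_bool (v = k) - of_bool (v = l)))
      \<le> (M d + 6)\<^sup>2 * ?R" if "k < ?n" "l < ?n" "k \<noteq> l" for k l
    by (rule card_realizations_surplus_deficit[OF many few nonneg that])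
  consider "s = 1" "s' = 1" | "s = -1" "s' = -1" | "i = j" "s' = - s"
    | "i \<noteq> j" "s = 1" "s' = -1" | "i \<noteq> j" "s = -1" "s' = 1"
    using s by (cases "i = j") auto
  then show ?thesis
  proof cases
    case 1
    then show ?thesis using surpluses by (intro *) simp
  next
    case 2
    then show ?thesis using deficits by (intro *) (simp add: algebra_simps)
  next
    case 3
    have "1 * ?R \<le> (M d)\<^sup>2 * ?R" using large by (intro mult_right_mono) auto
    then show ?thesis using 3 by simp
  next
    case 4
    then show ?thesis using mixed[OF ij] by (intro *) (simp add: algebra_simps)
  next
    case 5
    have "(\<lambda>v. t v + s * of_bool (v = i) + s' * of_bool (v = j))
      = (\<lambda>v. t v + of_bool (v = j) - of_bool (v = i))" using 5 by auto
    then show ?thesis using mixed[OF ij(2,1)] 5 by (intro *) (simp add: algebra_simps)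
  qed
qed

section \<open>Approaching the given sequence\<close>

lemma deviation_unit_step:
  assumes "i < length d" "f i \<noteq> int (d ! i)" and s: "s = sgn (f i - int (d ! i))"
  shows "deviation d (\<lambda>v. f v - s * of_bool (v = i)) = deviation d f - 1"
proof -
  have "deviation d (\<lambda>v. f v - s * of_bool (v = i)) =
      (\<Sum>v<length d. \<bar>f v - int (d ! v)\<bar> - of_bool (v = i))"
    unfolding deviation_def using assms by (intro sum.cong) (auto simp: sgn_if)
  then show ?thesis using assms(1) by (simp add: sum_subtractf deviation_def of_bool_def)
qed

text \<open>Moving a differing coordinate by one towards \<open>d\<close> reduces the deviation by one. It was
  even, so it is then odd, hence nonzero, and a second unit step is possible. Both steps go
  towards \<open>d\<close>, which keeps the values nonnegative.\<close>

lemma two_unit_steps: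
  assumes nonneg: "\<And>v. v < length d \<Longrightarrow> 0 \<le> f v"
    and even: "even (\<Sum>v<length d. f v)" "even (M d)" and ne: "deviation d f \<noteq> 0"
  obtains i j s s' t where "i < length d" "j < length d" "s \<in> {1, -1}" "s' \<in> {1, -1}"
    "f = (\<lambda>v. t v + s * of_bool (v = i) + s' * of_bool (v = j))"
    "deviation d t = deviation d f - 2" "\<forall>v<length d. 0 \<le> t v"
    "s = -1 \<or> int (d ! i) < f i" "s' = -1 \<or> int (d ! j) < f j"
proof -
  have differ: "\<exists>i<length d. g i \<noteq> int (d ! i)" if "deviation d g \<noteq> 0" for g
    using that unfolding deviation_def by (auto intro: ccontr)
  have parity: "even (deviation d f)"
  proof -
    have "even (\<Sum>v<length d. \<bar>f v - int (d ! v)\<bar>) = even (\<Sum>v<length d. f v - int (d ! v))"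
      by (simp add: even_sum_iff)
    also have "\<dots> = even ((\<Sum>v<length d. f v) - int (M d))" by (simp add: sum_subtractf M_eq_sum)
    finally show ?thesis using even by (simp add: deviation_def)
  qed
  obtain i where i: "i < length d" "f i \<noteq> int (d ! i)" using differ[OF ne] by blast
  define s where "s = sgn (f i - int (d ! i))"
  define g where "g = (\<lambda>v. f v - s * of_bool (v = i))"
  have g: "deviation d g = deviation d f - 1"
    using deviation_unit_step[of i d f s, OF i s_def] by (simp add: g_def)
  then have "odd (deviation d g)" using parity by simp
  then obtain j where j: "j < length d" "g j \<noteq> int (d ! j)" using differ[of g] by fastforce
  define s' where "s' = sgn (g j - int (d ! j))"
  define t where "t = (\<lambda>v. g v - s' * of_bool (v = j))"
  have t: "deviation d t = deviation d f - 2"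
    using deviation_unit_step[of j d g s', OF j s'_def] g by (simp add: t_def)
  have s: "s = 1 \<and> int (d ! i) < f i \<or> s = -1 \<and> f i < int (d ! i)" using i by (auto simp: s_def sgn_if)
  have s': "s' = 1 \<and> int (d ! j) < g j \<or> s' = -1 \<and> g j < int (d ! j)" using j by (auto simp: s'_def sgn_if)
  have g_nonneg: "0 \<le> g v" if "v < length d" for v
    using nonneg[OF that] s by (auto simp: g_def of_bool_def)
  have t_nonneg: "0 \<le> t v" if "v < length d" for v
    using g_nonneg[OF that] s' by (auto simp: t_def of_bool_def)
  have "s' = -1 \<or> int (d ! j) < f j" using s s' by (auto simp: g_def of_bool_def split: if_splits)
  then show ?thesis
    using that[OF i(1) j(1), of s s' t] s s' t t_nonneg by (auto simp: t_def g_def fun_eq_iff)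
qed

lemma card_realizations_le:
  assumes large: "2 * J d + 18 * max_degree d + 56 < M d" and "even (M d)" and "k \<le> 4"
    and "\<And>v. v < length d \<Longrightarrow> 0 \<le> f v" and "even (\<Sum>v<length d. f v)"
    and "deviation d f \<le> 2 * int k"
  shows "card (realizations (length d) f) \<le> M d ^ (2 * k) * card (Omega d)"
  using assms(3-)
proof (induction k arbitrary: f)
  have stop: "card (realizations (length d) f) \<le> M d ^ k * card (Omega d)"
    if "deviation d f \<le> 0" for f k
  proof -
    have "realizations (length d) f = Omega d"
      unfolding Omega_eq_realizations by (intro realizations_cong deviation_nonpos that)
    moreover have "1 * card (Omega d) \<le> M d ^ k * card (Omega d)"
      using large by (intro mult_right_mono) auto
    ultimately show ?thesis by simp
  qed
  {
    case 0
    then show ?case using stop[of f 0] by simp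
  next
    case (Suc k)
    show ?case
    proof (cases "deviation d f = 0")
      case True
      then show ?thesis using stop[of f "2 * Suc k"] by simp
    next
      case False
      obtain i j s s' t where t: "i < length d" "j < length d" "s \<in> {1, -1}" "s' \<in> {1, -1}"
        "f = (\<lambda>v. t v + s * of_bool (v = i) + s' * of_bool (v = j))"
        "deviation d t = deviation d f - 2" "\<forall>v<length d. 0 \<le> t v"
        "s = -1 \<or> int (d ! i) < f i" "s' = -1 \<or> int (d ! j) < f j"
        by (rule two_unit_steps[OF _ Suc.prems(3) \<open>even (M d)\<close> False]) (erule Suc.prems(2), rule that)
      have "(\<Sum>v<length d. f v) = (\<Sum>v<length d. t v) + s + s'"
        using t(1,2) by (simp add: t(5) sum.distrib sum_distrib_left[symmetric] of_bool_def)
      then have "even (\<Sum>v<length d. t v)" using Suc.prems(3) t(3,4) by auto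
      then have "card (realizations (length d) t) \<le> M d ^ (2 * k) * card (Omega d)"
        using Suc.IH[of t] Suc.prems t by simp
      moreover have "card (realizations (length d) f) \<le> (M d)\<^sup>2 * card (realizations (length d) t)"
        unfolding t(5) using Suc.prems t by (intro card_realizations_step[OF large]) auto
      ultimately have "card (realizations (length d) f) \<le> (M d)\<^sup>2 * (M d ^ (2 * k) * card (Omega d))"
        by (meson le_trans mult_le_mono2)
      then show ?thesis by (simp add: power_add power2_eq_square mult.assoc)
    qed
  }
qed

lemma l1_dist_eq_deviation: "l1_dist d' d = deviation d (\<lambda>v. int (d' ! v))"
  by (simp add: l1_dist_def deviation_def)

lemma stable_8_8_if_large:
  assumes "graphical d" and large: "2 * J d + 18 * max_degree d + 56 < M d"
  shows "k_alpha_stable 8 8 d"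
proof -
  have "real (card (Omega d')) \<le> real (M d) powr 8 * real (card (Omega d))"
    if "graphical d'" "length d' = length d" "l1_dist d' d \<le> int 8" for d'
  proof -
    have "even (\<Sum>v<length d. int (d' ! v))" "even (M d)"
      using that assms(1) M_eq_sum[of d', symmetric]
      by (auto simp: graphical_def degree_sequence_def M_def)
    then have "card (Omega d') \<le> M d ^ (2 * 4) * card (Omega d)"
      using card_realizations_le[OF large, of 4 "\<lambda>v. int (d' ! v)"] that
      by (simp add: Omega_eq_realizations[of d'] l1_dist_eq_deviation)
    then have "real (card (Omega d')) \<le> real (M d ^ 8 * card (Omega d))"
      by (simp del: of_nat_mult of_nat_power)
    also have "\<dots> = real (M d) powr 8 * real (card (Omega d))" using large by simp
    finally show ?thesis .
  qed
  then show ?thesis using assms(1) by (simp add: k_alpha_stable_def)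
qed

section \<open>The Jerrum--Sinclair state space\<close>

text \<open>Sums of degree sequences are even, so a sequence below \<open>d\<close> at distance at most two is \<open>d\<close> or
  results from \<open>d\<close> by two unit decrements. Conversely, the degrees of any graph with two unit
  deficits form a graphical sequence, because their sum is \<open>M d - 2\<close>.\<close>

lemma Omega'_eq:
  assumes "graphical d"
  shows "Omega' d = Omega d \<union> (\<Union>(i, j) \<in> {..<length d} \<times> {..<length d}.
    realizations (length d) (\<lambda>v. int (d ! v) - of_bool (v = i) - of_bool (v = j)))"
    (is "_ = _ \<union> (\<Union>(i, j) \<in> _. ?R i j)")
proof (intro equalityI subsetI)
  have even: "even (M d)" using assms by (simp add: graphical_def degree_sequence_def M_def)
  {
    fix G assume "G \<in> Omega' d"
    then obtain d' where d': "graphical d'" "length d' = length d" "l1_dist d' d \<le> 2"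
      "\<forall>v<length d. d' ! v \<le> d ! v" and G: "G \<in> Omega d'" by (auto simp: Omega'_def)
    let ?f = "\<lambda>v. int (d' ! v)"
    have G: "G \<in> realizations (length d) ?f" using G d'(2) by (simp add: Omega_eq_realizations)
    show "G \<in> Omega d \<union> (\<Union>(i, j) \<in> {..<length d} \<times> {..<length d}. ?R i j)"
    proof (cases "deviation d ?f = 0")
      case True
      then have "realizations (length d) ?f = Omega d"
        unfolding Omega_eq_realizations by (intro realizations_cong deviation_nonpos) auto
      then show ?thesis using G by simp
    next
      case False
      have "even (\<Sum>v<length d. ?f v)"
        using d' M_eq_sum[of d', symmetric] by (auto simp: graphical_def degree_sequence_def M_def)
      then obtain i j s s' t where t: "i < length d" "j < length d" "s \<in> {1, -1}" "s' \<in> {1, -1}"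
        "?f = (\<lambda>v. t v + s * of_bool (v = i) + s' * of_bool (v = j))"
        "deviation d t = deviation d ?f - 2" "\<forall>v<length d. 0 \<le> t v"
        "s = -1 \<or> int (d ! i) < ?f i" "s' = -1 \<or> int (d ! j) < ?f j"
        by (rule two_unit_steps[OF of_nat_0_le_iff _ even False]) (rule that)
      have "s = -1" "s' = -1" using t(1,2,8,9) d'(4) by (simp_all add: not_less[symmetric])
      moreover have "t v = int (d ! v)" if "v < length d" for v
        using deviation_nonpos[of d t v] that t(6) d'(3) by (simp add: l1_dist_eq_deviation)
      ultimately have "realizations (length d) ?f = ?R i j"
        unfolding t(5) by (intro realizations_cong) simp
      then show ?thesis using G t(1,2) by auto
    qed
  }
  fix G assume "G \<in> Omega d \<union> (\<Union>(i, j) \<in> {..<length d} \<times> {..<length d}. ?R i j)"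
  then consider "G \<in> Omega d" | i j where "i < length d" "j < length d" "G \<in> ?R i j" by auto
  then show "G \<in> Omega' d"
  proof cases
    case 1
    then show ?thesis using assms by (auto simp: Omega'_def l1_dist_def intro!: exI[of _ d])
  next
    case 2
    define d' where "d' = map (vertex_degree G) [0..<length d]"
    have len: "length d' = length d" by (simp add: d'_def)
    have nth: "int (d' ! v) = int (d ! v) - of_bool (v = i) - of_bool (v = j)" if "v < length d" for v
      using 2(3) that by (simp add: d'_def realizations_def)
    have G: "G \<in> Omega d'" using 2(3) by (simp add: Omega_def realizations_def d'_def)
    have "int (M d') = int (M d) - 2"
      using nth 2(1,2) by (simp add: M_eq_sum len sum_subtractf of_bool_def)
    then have "even (int (M d'))" using even by simp
    then have "graphical d'" using G by (auto simp: graphical_def degree_sequence_def M_def)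
    moreover have "l1_dist d' d \<le> 2"
    proof -
      have "l1_dist d' d \<le> (\<Sum>v<length d. of_bool (v = i) + of_bool (v = j))"
        unfolding l1_dist_def using nth by (intro sum_mono) auto
      also have "\<dots> = 2" using 2(1,2) by (simp add: sum.distrib of_bool_def)
      finally show ?thesis .
    qed
    moreover have "d' ! v \<le> d ! v" if "v < length d" for v
    proof -
      have "int (d' ! v) \<le> int (d ! v)" unfolding nth[OF that] by simp
      then show ?thesis by simp
    qed
    ultimately show ?thesis using G len by (auto simp: Omega'_def)
  qed
qed

lemma switchable_nonempty:
  assumes large: "2 * J d + 2 < M d"
    and H: "H \<in> realizations (length d) (\<lambda>v. int (d ! v) - of_bool (v = a) - of_bool (v = b))"
    and ab: "a < length d" "b < length d"
  shows "0 < card (switchable H a b)"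
proof -
  have "deviation d (\<lambda>v. int (d ! v)) \<le> int 0" by (simp add: deviation_def)
  from card_switchable[OF H ab this] show ?thesis using large by simp
qed

text \<open>A graph on \<open>n\<close> vertices has at most \<open>n\<^sup>2\<close> darts, so each of the \<open>n\<^sup>2\<close> choices of the
  two deficient vertices contributes at most \<open>n ^ 4 * card (Omega d)\<close>.\<close>

lemma card_Omega'_le:
  assumes "graphical d" and large: "2 * J d + 2 < M d"
  shows "card (Omega' d) \<le> (length d ^ 6 + 1) * card (Omega d)"
proof -
  let ?n = "length d"
  let ?R = "\<lambda>(i, j). realizations ?n (\<lambda>v. int (d ! v) - of_bool (v = i) - of_bool (v = j))"
  have few: "card (darts G) \<le> ?n\<^sup>2" if "G \<in> Omega d" for G
    using card_mono[OF _ darts_subset[of ?n G]] that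
    by (simp add: Omega_def card_cartesian_product power2_eq_square)
  have "card (?R p) \<le> ?n ^ 4 * card (Omega d)" if "p \<in> {..<?n} \<times> {..<?n}" for p
  proof (cases p)
    case (Pair i j)
    then have ij: "i < ?n" "j < ?n" using that by auto
    have many: "1 \<le> card (switchable H a b)"
      if "a < ?n" "b < ?n" "H \<in> realizations ?n (\<lambda>v. int (d ! v) - of_bool (v = a) - of_bool (v = b))"
      for H a b using switchable_nonempty[OF large that(3,1,2)] by simp
    have "1 * card (?R p) \<le> (?n\<^sup>2)\<^sup>2 * card (realizations ?n (\<lambda>v. int (d ! v)))"
      unfolding Pair prod.case
      by (rule card_realizations_two_deficits[OF many _ ij]) (use few in \<open>simp_all add: Omega_eq_realizations\<close>)
    then show ?thesis by (simp add: Omega_eq_realizations)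
  qed
  then have "card (\<Union>p \<in> {..<?n} \<times> {..<?n}. ?R p) \<le> (\<Sum>p \<in> {..<?n} \<times> {..<?n}. ?n ^ 4 * card (Omega d))"
    by (intro order.trans[OF card_UN_le] sum_mono) auto
  also have "\<dots> = ?n ^ 6 * card (Omega d)"
    by (simp add: card_cartesian_product eval_nat_numeral)
  finally have "card (\<Union>p \<in> {..<?n} \<times> {..<?n}. ?R p) \<le> ?n ^ 6 * card (Omega d)" .
  then show ?thesis unfolding Omega'_eq[OF assms(1)]
    by (intro order.trans[OF card_Un_le]) simp
qed

lemma P_stable_if_large:
  assumes "\<forall>d\<in>D. graphical d \<and> 2 * J d + 2 < M d"
  shows "P_stable D"
  unfolding P_stable_def
proof (intro exI allI impI ballI)
  fix n d assume "d \<in> D" "length d = n"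
  then have "real (card (Omega' d)) \<le> real ((n ^ 6 + 1) * card (Omega d))"
    using card_Omega'_le[of d] assms by (simp del: of_nat_mult of_nat_add)
  then show "real (card (Omega' d)) \<le> poly (monom 1 6 + 1) (real n) * real (card (Omega d))"
    by (simp add: poly_monom algebra_simps)
qed

text \<open>The intermediate graph \<open>G1\<close> has its deficits at \<open>b\<close> and \<open>y\<close>, which differ; so it is a
  state of the chain outside \<open>Omega d\<close>, as a hinge flip requires.\<close>

lemma JS_dist_le_2:
  assumes "graphical d" and large: "2 * J d + 2 < M d" and G: "G \<in> Omega' d"
  shows "JS_dist G d \<le> 2"
proof -
  have "\<exists>t\<le>2. \<exists>H\<in>Omega d. (G, H) \<in> JS_transitions d ^^ t"
  proof (cases "G \<in> Omega d")
    case True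
    then show ?thesis by (intro exI[of _ 0]) auto
  next
    case False
    let ?n = "length d" and ?d = "\<lambda>v. int (d ! v)"
    obtain a b where ab: "a < ?n" "b < ?n"
      and G_def: "G \<in> realizations ?n (\<lambda>v. ?d v - of_bool (v = a) - of_bool (v = b))"
      using G False unfolding Omega'_eq[OF assms(1)] by auto
    obtain x y where xy: "(x, y) \<in> switchable G a b"
      using switchable_nonempty[OF large G_def ab] by (fastforce simp: card_gt_0_iff)
    have simple: "simple_graph ?n G" and edge: "{x, y} \<in> G"
      using G_def xy by (auto simp: realizations_def switchable_def darts_def)
    define G1 where "G1 = insert {a, x} (G - {{x, y}})"
    define G2 where "G2 = switch G a b x y"
    have G1: "G1 \<in> realizations ?n (\<lambda>v. ?d v - of_bool (v = b) - of_bool (v = y))"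
      unfolding G1_def by (rule hinge_realizes[OF G_def ab(1) xy])
    then have G1': "G1 \<in> Omega' d"
      using ab simple_graph_edge(2)[OF simple edge] unfolding Omega'_eq[OF assms(1)] by blast
    have "G1 \<notin> Omega d"
      using G1 ab(2) by (force simp: Omega_eq_realizations realizations_def of_bool_def split: if_splits)
    moreover have "\<exists>u v w. {u, v} \<in> G \<and> {w, v} \<notin> G \<and> G1 = insert {w, v} (G - {{u, v}})"
    proof (intro exI conjI)
      show "{y, x} \<in> G" using edge by (simp add: insert_commute)
      show "{a, x} \<notin> G" using xy by (simp add: switchable_def)
      show "G1 = insert {a, x} (G - {{y, x}})" by (simp add: G1_def insert_commute[of y x])
    qed
    ultimately have first: "(G, G1) \<in> JS_transitions d"
      using G G1' False by (auto simp: JS_transitions_def hinge_flip_def)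
    have G2: "G2 \<in> Omega d"
      unfolding G2_def Omega_eq_realizations by (rule switch_realizes[OF G_def ab xy])
    have "{b, y} \<notin> G1"
      using xy switchable_new_edges_distinct[OF simple xy] by (auto simp: G1_def switchable_def)
    then have "insertion d G1 G2"
      using G2 unfolding insertion_def by (intro conjI exI[of _ "{b, y}"]) (simp_all add: G1_def G2_def switch_def)
    moreover have "G2 \<in> Omega' d" using G2 unfolding Omega'_eq[OF assms(1)] by blast
    ultimately have "(G1, G2) \<in> JS_transitions d" using G1' by (auto simp: JS_transitions_def)
    then have "(G, G2) \<in> JS_transitions d ^^ 2" using first by (auto simp: eval_nat_numeral)
    then show ?thesis using G2 by blast
  qed
  then obtain t where "t \<le> 2" "\<exists>H\<in>Omega d. (G, H) \<in> JS_transitions d ^^ t" by blast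
  then have "JS_dist G d \<le> enat t" unfolding JS_dist_def by (intro INF_lower) simp
  also have "\<dots> \<le> 2" using \<open>t \<le> 2\<close> by (simp add: numeral_eq_enat)
  finally show ?thesis .
qed

lemma strongly_stable_if_large:
  assumes "\<forall>d\<in>D. graphical d \<and> 2 * J d + 2 < M d"
  shows "strongly_stable D"
proof -
  have "k_JS d \<le> enat 2" if "d \<in> D" for d
    unfolding k_JS_def using that assms JS_dist_le_2 by (intro SUP_least) (simp add: numeral_eq_enat)
  then show ?thesis using assms unfolding strongly_stable_def by blast
qed

section \<open>Stability\<close>

theorem theorem2p2:
  shows "(\<forall>d :: nat list. graphical d \<and> M d > 2 * J d + 18 * max_degree d + 56 \<longrightarrow> k_alpha_stable 8 8 d)
    \<and> (\<forall>D :: nat list set.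
          (\<forall>d\<in>D. graphical d \<and> M d > 2 * J d + 6 * max_degree d + 2) \<longrightarrow>
            P_stable D \<and> strongly_stable D)"
proof (intro conjI allI impI)
  fix d :: "nat list"
  assume "graphical d \<and> M d > 2 * J d + 18 * max_degree d + 56"
  then show "k_alpha_stable 8 8 d" by (intro stable_8_8_if_large) auto
next
  fix D :: "nat list set"
  assume "\<forall>d\<in>D. graphical d \<and> M d > 2 * J d + 6 * max_degree d + 2"
  then have "\<forall>d\<in>D. graphical d \<and> 2 * J d + 2 < M d" by auto
  then show "P_stable D" "strongly_stable D"
    by (rule P_stable_if_large, rule strongly_stable_if_large)
qed

end
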